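(* Let $v=dm$ with $d,m$ positive integers, and let $A_i=[a_{i0},a_{i1},\ldots,a_{i,v-1}]$, $i=1,\ldots,t$, be complex sequences of length $v$ which are complementary with PAF-constants $\alpha_0,\alpha$, i.e. $\sum_{i=1}^t \mathrm{PAF}_{A_i}(0)=\alpha_0$ and $\sum_{i=1}^t \mathrm{PAF}_{A_i}(s)=\alpha$ for $s=1,\ldots,v-1$. Then the $m$-compressed sequences $A_i^{(d)}=[a_{i0}^{(d)},\ldots,a_{i,d-1}^{(d)}]$, $i=1,\ldots,t$, of length $d$ are complementary with PAF-constants $$\alpha_0^{(d)}=\alpha_0+(m-1)\alpha,\qquad \alpha^{(d)}=m\alpha,$$ i.e. $\sum_{i=1}^t \mathrm{PAF}_{A_i^{(d)}}(0)=\alpha_0^{(d)}$ and $\sum_{i=1}^t \mathrm{PAF}_{A_i^{(d)}}(s)=\alpha^{(d)}$ for $s=1,\ldots,d-1$. Moreover, the PSD-constants of the original and of the compressed sequences are the same: if $\beta_0,\beta$ are the PSD-constants of $A_1,\ldots,A_t$, then $\sum_{i=1}^t \mathrm{PSD}_{A_i^{(d)}}(0)=\beta_0$ and $\sum_{i=1}^t \mathrm{PSD}_{A_i^{(d)}}(s)=\beta$ for $s=1,\ldots,d-1$.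
   Context: For a complex sequence $A=[a_0,\ldots,a_{\ell-1}]$ of length $\ell$ (indices modulo $\ell$): the periodic autocorrelation function is $\mathrm{PAF}_A(s)=\sum_{j=0}^{\ell-1}a_{j+s}\overline{a_j}$ for $s\in\mathbb{Z}_\ell$; the discrete Fourier transform is $\mathrm{DFT}_A(s)=\sum_{j=0}^{\ell-1}a_j\omega^{js}$ with $\omega=e^{2\pi i/\ell}$; the power spectral density is $\mathrm{PSD}_A(s)=|\mathrm{DFT}_A(s)|^2$. Sequences $A_1,\ldots,A_t$ of length $\ell$ are complementary with PAF-constants $\alpha_0,\alpha$ if $\sum_i\mathrm{PAF}_{A_i}=[\alpha_0,\alpha,\ldots,\alpha]$ (value $\alpha_0$ at shift $0$ and $\alpha$ at all nonzero shifts). The PSD-constants of such a collection are the numbers $\beta_0=\alpha_0+(\ell-1)\alpha$ and $\beta=\alpha_0-\alpha$; they satisfy $\sum_i\mathrm{PSD}_{A_i}=[\beta_0,\beta,\ldots,\beta]$. If $A=[a_0,\ldots,a_{v-1}]$ has length $v=dm$, its $m$-compression is the sequence $A^{(d)}=[a_0^{(d)},\ldots,a_{d-1}^{(d)}]$ of length $d$ with $a_j^{(d)}=a_j+a_{j+d}+\cdots+a_{j+(m-1)d}$ for $j=0,\ldots,d-1$. *)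

theory Defs
  imports "HOL-Analysis.Analysis"
begin

(* Shifts in the integers modulo the length are represented by natural numbers. *)
definition paf :: "complex list \<Rightarrow> nat \<Rightarrow> complex" where
  "paf A s = (\<Sum>j<length A. A ! ((j + s) mod length A) * cnj (A ! j))"

definition dft :: "complex list \<Rightarrow> nat \<Rightarrow> complex" where
  "dft A s = (\<Sum>j<length A. A ! j * exp (2 * of_real pi * \<i> / of_nat (length A)) ^ (j * s))"

definition psd :: "complex list \<Rightarrow> nat \<Rightarrow> real" where
  "psd A s = (cmod (dft A s))\<^sup>2"

(* The sequences are A 1, ..., A t, each of length l. For l = 1 the constant \<alpha> is unconstrained. *)
definition complementary ::
  "nat \<Rightarrow> nat \<Rightarrow> (nat \<Rightarrow> complex list) \<Rightarrow> complex \<Rightarrow> complex \<Rightarrow> bool" where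
  "complementary l t A \<alpha>\<^sub>0 \<alpha> \<longleftrightarrow>
     (\<forall>i\<in>{1..t}. length (A i) = l) \<and>
     (\<Sum>i=1..t. paf (A i) 0) = \<alpha>\<^sub>0 \<and>
     (\<forall>s\<in>{1..<l}. (\<Sum>i=1..t. paf (A i) s) = \<alpha>)"

(* The PSD-constants of sequences of length l with PAF-constants \<alpha>\<^sub>0 and \<alpha>. *)
definition psd_const0 :: "nat \<Rightarrow> complex \<Rightarrow> complex \<Rightarrow> complex" where
  "psd_const0 l \<alpha>\<^sub>0 \<alpha> = \<alpha>\<^sub>0 + (of_nat l - 1) * \<alpha>"

definition psd_const :: "complex \<Rightarrow> complex \<Rightarrow> complex" where
  "psd_const \<alpha>\<^sub>0 \<alpha> = \<alpha>\<^sub>0 - \<alpha>"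

(* Intended for m > 0 dividing the length of A; d is the length of the result. *)
definition compress :: "nat \<Rightarrow> complex list \<Rightarrow> complex list" where
  "compress m A =
     (let d = length A div m in map (\<lambda>j. \<Sum>k<m. A ! (j + k * d)) [0..<d])"

end

theory Submission
  imports Defs
begin

text \<open>
  The residue class of \<open>s\<close> modulo \<open>d\<close> consists of the \<open>m\<close> shifts \<open>s + k * d\<close> modulo \<open>d * m\<close>, and the
  autocorrelation of the compression at \<open>s\<close> is the sum of the original autocorrelations over this
  class. The class of \<open>0\<close> contributes \<open>\<alpha>\<^sub>0 + (m - 1) * \<alpha>\<close>, any other class \<open>m * \<alpha>\<close>.
  The spectral claims follow because the PSD is the Fourier transform of the PAF.
\<close>

text \<open>Translation by \<open>q\<close> permutes the residues modulo \<open>m\<close>: it is an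
  injective map of a finite set into itself. This serves both to rotate residue classes and to start
  a DFT sum at any position.\<close>

lemma sum_mod_shift:
  fixes f :: "nat \<Rightarrow> 'a::comm_monoid_add"
  assumes "m > 0"
  shows "(\<Sum>k<m. f ((q + k) mod m)) = (\<Sum>k<m. f k)"
proof -
  have inj: "inj_on (\<lambda>k. (q + k) mod m) {..<m}"
  proof (rule inj_onI)
    fix x y assume "x \<in> {..<m}" "y \<in> {..<m}" "(q + x) mod m = (q + y) mod m"
    then have "x mod m = y mod m"
      unfolding nat_mod_eq_iff by (simp add: add.assoc)
    with \<open>x \<in> {..<m}\<close> \<open>y \<in> {..<m}\<close> show "x = y" by simp
  qed
  then have "(\<lambda>k. (q + k) mod m) ` {..<m} = {..<m}"
    using assms by (intro endo_inj_surj) auto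
  with inj have "bij_betw (\<lambda>k. (q + k) mod m) {..<m} {..<m}"
    by (simp add: bij_betw_def)
  then show ?thesis
    by (rule sum.reindex_bij_betw)
qed

lemma sum_lessThan_mult:
  fixes f :: "nat \<Rightarrow> 'a::comm_monoid_add"
  shows "(\<Sum>n<d * m. f n) = (\<Sum>j<d. \<Sum>k<m. f (j + k * d))"
proof -
  have "(\<Sum>n<d * m. f n) = (\<Sum>k<m. sum f {k * d..<k * d + d})"
    by (simp add: sum.nat_group mult.commute)
  also have "\<dots> = (\<Sum>k<m. \<Sum>j<d. f (j + k * d))"
    using sum.shift_bounds_nat_ivl[of f 0 "k * d" d for k]
    by (simp add: add.commute[of d] atLeast0LessThan)
  also have "\<dots> = (\<Sum>j<d. \<Sum>k<m. f (j + k * d))"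
    by (rule sum.swap)
  finally show ?thesis .
qed

text \<open>With \<open>q = x div d\<close>, reduction modulo \<open>d * m\<close> keeps the
  remainder \<open>x mod d\<close> and turns the block number \<open>q + k\<close> into
  \<open>(q + k) mod m\<close>, so the two sums differ by a rotation in \<open>k\<close>.\<close>

lemma sum_residue_class:
  fixes f :: "nat \<Rightarrow> 'a::comm_monoid_add"
  assumes "m > 0"
  shows "(\<Sum>k<m. f ((x + k * d) mod (d * m))) = (\<Sum>k<m. f (x mod d + k * d))"
proof -
  have "(x + k * d) mod (d * m) = x mod d + ((x div d + k) mod m) * d" for k
    \<comment> \<open>For \<open>d = 0\<close> both sides are \<open>x\<close>, since
      \<open>x mod 0 = x\<close>.\<close>
    by (cases "d = 0") (simp_all add: mod_mult2_eq mult.commute add.commute)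
  then show ?thesis
    using sum_mod_shift[OF assms, of "\<lambda>k. f (x mod d + k * d)" "x div d"] by simp
qed

lemma length_compress:
  assumes "m > 0" "length A = d * m"
  shows "length (compress m A) = d"
  using assms by (simp add: compress_def Let_def)

lemma nth_compress:
  assumes "m > 0" "length A = d * m" "j < d"
  shows "compress m A ! j = (\<Sum>k<m. A ! (j + k * d))"
  using assms by (simp add: compress_def Let_def)

text \<open>For fixed \<open>n\<close>, summing over \<open>k\<close> runs through the residue class
  of \<open>n + s\<close> modulo \<open>d\<close> and so yields an entry of the compression. That
  entry depends on \<open>n\<close> only modulo \<open>d\<close>; grouping
  \<open>n = j + k * d\<close> then compresses the conjugated factor as well.\<close>

lemma paf_compress:
  assumes m: "m > 0" and len: "length A = d * m"
  shows "paf (compress m A) s = (\<Sum>k<m. paf A (s + k * d))"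
proof -
  have cls: "(\<Sum>k<m. A ! ((n + s + k * d) mod (d * m))) = compress m A ! ((n + s) mod d)"
    if "d > 0" for n
    using that sum_residue_class[OF m, of "(!) A" "n + s" d]
    by (simp add: nth_compress[OF m len])
  have "(\<Sum>k<m. paf A (s + k * d))
      = (\<Sum>n<d * m. (\<Sum>k<m. A ! ((n + s + k * d) mod (d * m))) * cnj (A ! n))"
    unfolding paf_def len by (subst sum.swap) (simp add: sum_distrib_right add.assoc)
  also have "\<dots> = (\<Sum>n<d * m. compress m A ! ((n + s) mod d) * cnj (A ! n))"
    \<comment> \<open>An index below \<open>d * m\<close> forces \<open>d > 0\<close>, as
      \<open>cls\<close> demands.\<close>
    by (rule sum.cong) (auto simp: cls dest: gr_implies_not0)
  also have "\<dots> = (\<Sum>j<d. \<Sum>k<m. compress m A ! ((j + s) mod d) * cnj (A ! (j + k * d)))"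
  proof -
    have "(j + k * d + s) mod d = (j + s) mod d" for j k
      by (metis add.assoc add.commute mod_mult_self1)
    then show ?thesis by (simp add: sum_lessThan_mult)
  qed
  also have "\<dots> = (\<Sum>j<d. compress m A ! ((j + s) mod d) * cnj (compress m A ! j))"
    by (simp add: nth_compress[OF m len] sum_distrib_left)
  also have "\<dots> = paf (compress m A) s"
    by (simp add: paf_def length_compress[OF m len])
  finally show ?thesis ..
qed

lemma complementary_compress:
  assumes d: "d > 0" and m: "m > 0" and comp: "complementary (d * m) t A \<alpha>\<^sub>0 \<alpha>"
  shows "complementary d t (\<lambda>i. compress m (A i)) (\<alpha>\<^sub>0 + (of_nat m - 1) * \<alpha>) (of_nat m * \<alpha>)"
proof -
  have len: "length (A i) = d * m" if "i \<in> {1..t}" for i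
    using comp that by (auto simp: complementary_def)
  have paf0: "(\<Sum>i=1..t. paf (A i) 0) = \<alpha>\<^sub>0"
    and paf: "\<And>s. s \<in> {1..<d * m} \<Longrightarrow> (\<Sum>i=1..t. paf (A i) s) = \<alpha>"
    using comp by (auto simp: complementary_def)
  have eq: "(\<Sum>i=1..t. paf (compress m (A i)) s) = (\<Sum>k<m. \<Sum>i=1..t. paf (A i) (s + k * d))" for s
    by (subst sum.swap) (simp add: paf_compress[OF m len])
  \<comment> \<open>These shifts need no reduction modulo \<open>d * m\<close>, so the hypothesis
    gives \<alpha> for each of them except the shift zero.\<close>
  have lt: "s + k * d < d * m" if "s < d" "k < m" for s k
  proof -
    have "s + k * d < Suc k * d" using that by simp
    also have "\<dots> \<le> m * d" using that by (intro mult_le_mono1) simp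
    finally show ?thesis by (simp add: mult.commute)
  qed
  \<comment> \<open>As \<open>d > 0\<close>, the shift \<open>k * d\<close> vanishes only for
    \<open>k = 0\<close>.\<close>
  have "(\<Sum>i=1..t. paf (compress m (A i)) 0) = (\<Sum>k<m. if k = 0 then \<alpha>\<^sub>0 else \<alpha>)"
    unfolding eq
  proof (rule sum.cong)
    fix k assume "k \<in> {..<m}"
    then show "(\<Sum>i=1..t. paf (A i) (0 + k * d)) = (if k = 0 then \<alpha>\<^sub>0 else \<alpha>)"
      using paf0 paf[of "k * d"] lt[of 0 k] d by auto
  qed simp
  also have "\<dots> = \<alpha>\<^sub>0 + (of_nat m - 1) * \<alpha>"
    using m by (cases m) (simp_all add: sum.lessThan_Suc_shift del: sum.lessThan_Suc)
  finally have "(\<Sum>i=1..t. paf (compress m (A i)) 0) = \<alpha>\<^sub>0 + (of_nat m - 1) * \<alpha>" .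
  moreover have "(\<Sum>i=1..t. paf (compress m (A i)) s) = of_nat m * \<alpha>" if "s \<in> {1..<d}" for s
  proof -
    have "(\<Sum>i=1..t. paf (compress m (A i)) s) = (\<Sum>k<m. \<alpha>)"
      unfolding eq using that lt by (intro sum.cong refl paf) auto
    then show ?thesis by simp
  qed
  ultimately show ?thesis
    by (auto simp: complementary_def length_compress[OF m len])
qed

lemma root_unity_power_eq_1_iff:
  assumes "l > 0"
  shows "exp (2 * of_real pi * \<i> / of_nat l) ^ n = 1 \<longleftrightarrow> l dvd n"
proof -
  have "exp (2 * of_real pi * \<i> / of_nat l) ^ n
      = exp (2 * of_real pi * \<i> * of_nat n / of_nat l)"
    by (simp add: mult_ac flip: exp_of_nat_mult)
  then show ?thesis
    using complex_root_unity_eq_1[of l n] assms by simp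
qed

text \<open>A finite Wiener-Khinchin identity. In the DFT times its conjugate, the term of the
  conjugate at \<open>j\<close> is paired with the DFT summed from position \<open>j\<close>
  onwards; the phase \<open>\<omega> ^ (j * s)\<close> cancels, and summing over \<open>j\<close>
  leaves the PAF at the offset \<open>u\<close>.\<close>

lemma psd_eq_sum_paf:
  fixes A :: "complex list"
  defines "\<omega> \<equiv> exp (2 * of_real pi * \<i> / of_nat (length A))"
  assumes pos: "length A > 0"
  shows "complex_of_real (psd A s) = (\<Sum>u<length A. paf A u * \<omega> ^ (u * s))"
proof -
  define l where "l = length A"
  have l: "l > 0" and w: "\<omega> ^ l = 1"
    using pos root_unity_power_eq_1_iff[of l l] by (simp_all add: l_def \<omega>_def)
  have "norm \<omega> = 1"
    by (simp add: \<omega>_def)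
  then have unit: "\<omega> ^ k * cnj (\<omega> ^ k) = 1" for k
    by (simp only: norm_power power_one of_real_1 flip: complex_norm_square)
  \<comment> \<open>Exponents of \<omega> matter only modulo \<open>l\<close>, so the wrap-around of
    a cyclic shift does not affect the phase.\<close>
  have wmod: "\<omega> ^ ((n mod l) * s) = \<omega> ^ (n * s)" for n
  proof -
    have "\<omega> ^ n = \<omega> ^ (l * (n div l) + n mod l)" by simp
    also have "\<dots> = \<omega> ^ (n mod l)" by (simp only: power_add power_mult w) simp
    finally show ?thesis by (simp add: power_mult)
  qed
  have dft: "dft A s = (\<Sum>u<l. A ! ((j + u) mod l) * (\<omega> ^ (j * s) * \<omega> ^ (u * s)))" for j
  proof -
    have "dft A s = (\<Sum>u<l. A ! ((j + u) mod l) * \<omega> ^ (((j + u) mod l) * s))"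
      using sum_mod_shift[OF l, of "\<lambda>n. A ! n * \<omega> ^ (n * s)" j]
      by (simp add: dft_def \<omega>_def l_def)
    then show ?thesis
      by (simp add: wmod distrib_right power_add)
  qed
  have "complex_of_real (psd A s) = dft A s * cnj (dft A s)"
    by (simp only: psd_def of_real_power flip: complex_norm_square)
  also have "cnj (dft A s) = (\<Sum>j<l. cnj (A ! j) * cnj (\<omega> ^ (j * s)))"
    by (simp add: dft_def \<omega>_def l_def)
  also have "dft A s * \<dots> = (\<Sum>j<l. dft A s * (cnj (A ! j) * cnj (\<omega> ^ (j * s))))"
    by (rule sum_distrib_left)
  also have "\<dots> = (\<Sum>j<l. \<Sum>u<l. A ! ((j + u) mod l) * cnj (A ! j) * \<omega> ^ (u * s))"
  proof (rule sum.cong[OF refl])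
    fix j
    have "dft A s * (cnj (A ! j) * cnj (\<omega> ^ (j * s)))
        = (\<Sum>u<l. A ! ((j + u) mod l) * cnj (A ! j) * \<omega> ^ (u * s)
            * (\<omega> ^ (j * s) * cnj (\<omega> ^ (j * s))))"
      unfolding dft[of j] sum_distrib_right by (simp only: mult_ac)
    then show "dft A s * (cnj (A ! j) * cnj (\<omega> ^ (j * s)))
        = (\<Sum>u<l. A ! ((j + u) mod l) * cnj (A ! j) * \<omega> ^ (u * s))"
      by (simp only: unit mult_1_right)
  qed
  also have "\<dots> = (\<Sum>u<l. paf A u * \<omega> ^ (u * s))"
    by (subst sum.swap) (simp add: paf_def l_def sum_distrib_right)
  finally show ?thesis by (simp add: l_def)
qed

text \<open>The summed PAF is the constant \<alpha> plus a spike
  \<open>\<alpha>\<^sub>0 - \<alpha>\<close> at shift 0. The spike has a flat spectrum; the constant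
  contributes a geometric sum over roots of unity, equal to \<open>l\<close> at frequency 0 and to 0
  at the others.\<close>

lemma complementary_psd:
  assumes l: "l > 0" and comp: "complementary l t A \<alpha>\<^sub>0 \<alpha>"
  shows "(\<Sum>i=1..t. complex_of_real (psd (A i) 0)) = psd_const0 l \<alpha>\<^sub>0 \<alpha>"
    and "s \<in> {1..<l} \<Longrightarrow> (\<Sum>i=1..t. complex_of_real (psd (A i) s)) = psd_const \<alpha>\<^sub>0 \<alpha>"
proof -
  define \<omega> where "\<omega> = exp (2 * of_real pi * \<i> / of_nat l)"
  have len: "length (A i) = l" if "i \<in> {1..t}" for i
    using comp that by (auto simp: complementary_def)
  have psd: "(\<Sum>i=1..t. complex_of_real (psd (A i) r)) = \<alpha>\<^sub>0 - \<alpha> + \<alpha> * (\<Sum>u<l. (\<omega> ^ r) ^ u)" for r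
  proof -
    have "(\<Sum>i=1..t. complex_of_real (psd (A i) r)) = (\<Sum>i=1..t. \<Sum>u<l. paf (A i) u * \<omega> ^ (u * r))"
      using l by (intro sum.cong refl) (simp add: psd_eq_sum_paf len \<omega>_def)
    also have "\<dots> = (\<Sum>u<l. (\<Sum>i=1..t. paf (A i) u) * \<omega> ^ (u * r))"
      by (subst sum.swap) (simp add: sum_distrib_right)
    also have "\<dots> = (\<Sum>u<l. (if u = 0 then \<alpha>\<^sub>0 - \<alpha> else 0) + \<alpha> * (\<omega> ^ r) ^ u)"
      using comp by (intro sum.cong refl)
        (auto simp: complementary_def simp flip: power_mult mult.commute[of r])
    also have "\<dots> = \<alpha>\<^sub>0 - \<alpha> + \<alpha> * (\<Sum>u<l. (\<omega> ^ r) ^ u)"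
      using l by (simp add: sum.distrib sum_distrib_left)
    finally show ?thesis .
  qed
  show "(\<Sum>i=1..t. complex_of_real (psd (A i) 0)) = psd_const0 l \<alpha>\<^sub>0 \<alpha>"
    unfolding psd by (simp add: psd_const0_def algebra_simps)
  assume s: "s \<in> {1..<l}"
  then have "\<omega> ^ s \<noteq> 1"
    using l by (auto simp: \<omega>_def root_unity_power_eq_1_iff dest: dvd_imp_le)
  moreover have "(\<omega> ^ s) ^ l = 1"
    using l by (simp add: \<omega>_def root_unity_power_eq_1_iff flip: power_mult)
  ultimately have "(\<Sum>u<l. (\<omega> ^ s) ^ u) = 0"
    by (simp add: sum_gp_strict)
  then show "(\<Sum>i=1..t. complex_of_real (psd (A i) s)) = psd_const \<alpha>\<^sub>0 \<alpha>"
    unfolding psd by (simp add: psd_const_def)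
qed

theorem theorem3:
  fixes v d m t :: nat
    and A :: "nat \<Rightarrow> complex list"
    and \<alpha>\<^sub>0 \<alpha> \<alpha>\<^sub>0d \<alpha>d \<beta>\<^sub>0 \<beta> :: complex
  assumes "d > 0" and "m > 0" and "v = d * m"
    and "complementary v t A \<alpha>\<^sub>0 \<alpha>"
    and "\<alpha>\<^sub>0d = \<alpha>\<^sub>0 + (of_nat m - 1) * \<alpha>" and "\<alpha>d = of_nat m * \<alpha>"
    and "\<beta>\<^sub>0 = psd_const0 v \<alpha>\<^sub>0 \<alpha>" and "\<beta> = psd_const \<alpha>\<^sub>0 \<alpha>"
  shows "complementary d t (\<lambda>i. compress m (A i)) \<alpha>\<^sub>0d \<alpha>d
    \<and> psd_const0 d \<alpha>\<^sub>0d \<alpha>d = \<beta>\<^sub>0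
    \<and> psd_const \<alpha>\<^sub>0d \<alpha>d = \<beta>
    \<and> (\<Sum>i=1..t. complex_of_real (psd (compress m (A i)) 0)) = \<beta>\<^sub>0
    \<and> (\<forall>s\<in>{1..<d}. (\<Sum>i=1..t. complex_of_real (psd (compress m (A i)) s)) = \<beta>)"
proof -
  have comp: "complementary d t (\<lambda>i. compress m (A i)) \<alpha>\<^sub>0d \<alpha>d"
    using complementary_compress[of d m t A \<alpha>\<^sub>0 \<alpha>] assms by simp
  \<comment> \<open>Indeed \<open>(m - 1) + (d - 1) * m = d * m - 1\<close> and
    \<open>(m - 1) - m = -1\<close> are the resulting coefficients of \<alpha>.\<close>
  have "psd_const0 d \<alpha>\<^sub>0d \<alpha>d = \<beta>\<^sub>0" "psd_const \<alpha>\<^sub>0d \<alpha>d = \<beta>"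
    by (simp_all add: assms psd_const0_def psd_const_def algebra_simps)
  \<comment> \<open>The spectral lemma is applied to the compressed sequences themselves, whose
    PSD-constants have just been identified with the original ones.\<close>
  with comp complementary_psd[OF \<open>d > 0\<close> comp] show ?thesis
    by simp
qed

end
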